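(* Let $n_1, n_2, n_3 \ge 2$ be integers. If it is not the case that two of the $n_i$ equal $2$ and the third is odd, then $\mathrm{ip}(K_{n_1} \Box K_{n_2} \Box K_{n_3}) = \lceil n_1 n_2 n_3/4 \rceil$. If two of the $n_i$ equal $2$ and the third is odd, then $\mathrm{ip}(K_{n_1} \Box K_{n_2} \Box K_{n_3}) = n_1 n_2 n_3/4 + 1$.
   Context: An isometric path between two vertices of a graph is a shortest path joining them. The isometric path number $\mathrm{ip}(G)$ of a graph $G$ is the minimum number of isometric paths needed to cover all vertices of $G$. $K_m$ denotes the complete graph on $m$ vertices. The Cartesian product $K_{n_1} \Box \cdots \Box K_{n_r}$ has vertex set $\{(x_1,\ldots,x_r) : 0 \le x_i < n_i\}$, with two vertices adjacent if and only if they differ in exactly one coordinate. *)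

theory Defs
  imports Complex_Main "Graph_Theory.Graph_Theory"
begin

text \<open>
  Undirected graphs are symmetric digraphs, as in the library. The graphs considered here are simple, so
  a path is identified with its list of vertices (\<^const>\<open>vpath\<close>); a single vertex is a path of length
  0, and a path and its reversal are distinct lists, which does not affect the minimum below.
\<close>

definition isometric_path :: "('a, 'b) pre_digraph \<Rightarrow> 'a list \<Rightarrow> bool" where
  "isometric_path G p \<longleftrightarrow> vpath p G \<and>
     (\<forall>q. vpath q G \<and> hd q = hd p \<and> last q = last p \<longrightarrow> vwalk_length p \<le> vwalk_length q)"

definition isometric_path_cover :: "('a, 'b) pre_digraph \<Rightarrow> 'a list set \<Rightarrow> bool" where
  "isometric_path_cover G P \<longleftrightarrow> finite P \<and> (\<forall>p\<in>P. isometric_path G p) \<and> (\<Union>p\<in>P. set p) = verts G"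

definition isometric_path_number :: "('a, 'b) pre_digraph \<Rightarrow> nat" where
  "isometric_path_number G = (LEAST k. \<exists>P. isometric_path_cover G P \<and> card P = k)"

text \<open>
  The Cartesian product of the complete graphs on \<open>ns ! 0, \<dots>, ns ! (r - 1)\<close> vertices, where
  \<open>r = length ns\<close>; the tuple \<open>(x\<^sub>1, \<dots>, x\<^sub>r)\<close> is a list of length \<open>r\<close>.
\<close>

definition complete_product_verts :: "nat list \<Rightarrow> nat list set" where
  "complete_product_verts ns = {x. length x = length ns \<and> (\<forall>i<length ns. x ! i < ns ! i)}"

definition complete_product :: "nat list \<Rightarrow> nat list pair_pre_digraph" where
  "complete_product ns =
     \<lparr> pverts = complete_product_verts ns,
       parcs = {(x, y). x \<in> complete_product_verts ns \<and> y \<in> complete_product_verts ns \<and>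
                        (\<exists>!i. i < length ns \<and> x ! i \<noteq> y ! i)} \<rparr>"

lemma finite_complete_product_verts: "finite (complete_product_verts ns)"
proof (rule finite_subset)
  show "complete_product_verts ns \<subseteq> {x. set x \<subseteq> {..<Max (set ns)} \<and> length x = length ns}"
  proof clarify
    fix x assume x: "x \<in> complete_product_verts ns"
    then have len: "length x = length ns" by (simp add: complete_product_verts_def)
    have "a < Max (set ns)" if "a \<in> set x" for a
    proof -
      from that obtain i where i: "i < length x" "a = x ! i" by (auto simp: in_set_conv_nth)
      then have "a < ns ! i" using x by (simp add: complete_product_verts_def)
      also have "ns ! i \<le> Max (set ns)" using i len by simp
      finally show ?thesis .
    qed
    then show "set x \<subseteq> {..<Max (set ns)} \<and> length x = length ns" using len by auto
  qed
  show "finite {x. set x \<subseteq> {..<Max (set ns)} \<and> length x = length ns}"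
    by (rule finite_lists_length_eq) simp
qed

lemma pair_graph_complete_product: "pair_graph (complete_product ns)"
proof -
  let ?V = "complete_product_verts ns" and ?A = "parcs (complete_product ns)"
  have arcs: "(x, y) \<in> ?A \<longleftrightarrow> x \<in> ?V \<and> y \<in> ?V \<and> (\<exists>!i. i < length ns \<and> x ! i \<noteq> y ! i)" for x y
    by (simp only: complete_product_def pair_pre_digraph.simps mem_Collect_eq prod.case)
  have verts: "pverts (complete_product ns) = ?V"
    by (simp only: complete_product_def pair_pre_digraph.simps)
  have sub: "?A \<subseteq> ?V \<times> ?V"
    by (rule subrelI) (simp only: arcs mem_Sigma_iff)
  have "(y, x) \<in> ?A" if "(x, y) \<in> ?A" for x y
    using that unfolding arcs by (simp only: eq_commute[of "y ! _" "x ! _"])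
  then have sym: "sym ?A"
    by (rule symI)
  have "x \<noteq> y" if "(x, y) \<in> ?A" for x y
  proof -
    from that obtain i where "x ! i \<noteq> y ! i"
      unfolding arcs by (blast dest: ex1_implies_ex)
    then show ?thesis by metis
  qed
  then have loopfree: "fst e \<noteq> snd e" if "e \<in> ?A" for e
    using that by (metis prod.collapse)
  show ?thesis
  proof
    show "finite (pverts (complete_product ns))"
      unfolding verts by (rule finite_complete_product_verts)
    show "finite ?A"
      using sub by (rule finite_subset) (simp only: finite_cartesian_product finite_complete_product_verts)
    show "symmetric (complete_product ns)"
      unfolding symmetric_def arcs_ends_def arc_to_ends_def using sym by simp
  next
    fix e assume e: "e \<in> ?A"
    then have "e \<in> ?V \<times> ?V" using sub by (rule rev_subsetD)
    then show "fst e \<in> pverts (complete_product ns)" "snd e \<in> pverts (complete_product ns)"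
      unfolding verts by (simp_all only: mem_Times_iff)
    show "fst e \<noteq> snd e" using e by (rule loopfree)
  qed
qed

text \<open>Covers exist, so the \<open>LEAST\<close> above is attained.\<close>

lemma isometric_path_number_attained:
  assumes "finite (verts G)"
  shows "\<exists>P. isometric_path_cover G P \<and> card P = isometric_path_number G"
proof -
  have "isometric_path G [v]" if "v \<in> verts G" for v
    using that by (simp add: isometric_path_def vpath_def vwalk_def)
  with assms have "isometric_path_cover G ((\<lambda>v. [v]) ` verts G)"
    by (simp add: isometric_path_cover_def)
  then have "\<exists>k P. isometric_path_cover G P \<and> card P = k"
    by metis
  then show ?thesis
    unfolding isometric_path_number_def by (rule LeastI_ex)
qed

end

theory Submission
  imports Defs
begin

text \<open>
  The product has diameter 3, so an isometric path has at most four vertices and at least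
  \<open>n\<^sub>1 n\<^sub>2 n\<^sub>3 / 4\<close> paths are needed. Efficient covers can be glued along a coordinate as soon as one of
  them is a partition into paths of four vertices; gluing partitions of the boxes \<open>4 \<times> m \<times> n\<close> reduces
  each coordinate modulo 4, and leaves finitely many small boxes, which are covered explicitly.

  In the exceptional case suppose that \<open>n\<close> paths cover the \<open>n\<close> layers of \<open>2 \<times> 2 \<times> n\<close>. Then they are disjoint,
  have four vertices each and meet the layers in parts of sizes 3 and 1, or 2 and 2. A layer with
  a part of size 3 has one of size 1, and by counting there are no other parts of size 1; hence each
  layer is of type 3 + 1 or 2 + 2. A path of type 3 + 1 has its middle vertex and its single vertex of
  opposite parity, but a layer of type 3 + 1 has them of the same parity; hence the paths of type 3 + 1
  have even number. A path of type 2 + 2 has one edge in each direction, but in a layer of type 2 + 2 both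
  edges have the same direction; hence the paths of type 2 + 2 have even number. So \<open>n\<close> is even.
\<close>

section \<open>Geodesics of the product of three complete graphs\<close>

text \<open>The Hamming distance, which is the path metric of the product. Triples replace
  coordinate lists so that simplification can split coordinates.\<close>

fun hdist :: "nat \<times> nat \<times> nat \<Rightarrow> nat \<times> nat \<times> nat \<Rightarrow> nat" where
  "hdist (a, b, c) (x, y, z) = of_bool (a \<noteq> x) + of_bool (b \<noteq> y) + of_bool (c \<noteq> z)"

definition box :: "nat \<Rightarrow> nat \<Rightarrow> nat \<Rightarrow> (nat \<times> nat \<times> nat) set" where
  "box a b c = {..<a} \<times> {..<b} \<times> {..<c}"

text \<open>No box is mentioned: a walk as long as the Hamming distance of its ends is shortest in
  every box that contains it.\<close>

definition geodesic :: "(nat \<times> nat \<times> nat) list \<Rightarrow> bool" where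
  "geodesic p \<longleftrightarrow> p \<noteq> [] \<and> successively (\<lambda>u v. hdist u v = 1) p \<and>
     hdist (hd p) (last p) = length p - 1"

text \<open>With a list in place of a set of paths, counting concerns lengths only and covers are
  glued by appending.\<close>

definition coverable :: "nat \<Rightarrow> nat \<Rightarrow> nat \<Rightarrow> nat \<Rightarrow> bool" where
  "coverable a b c k \<longleftrightarrow>
     (\<exists>ps. length ps = k \<and> (\<forall>p\<in>set ps. geodesic p) \<and> (\<Union>p\<in>set ps. set p) = box a b c)"

lemma mem_box [simp]: "(x, y, z) \<in> box a b c \<longleftrightarrow> x < a \<and> y < b \<and> z < c"
  by (simp add: box_def)

lemma finite_box [simp]: "finite (box a b c)"
  by (simp add: box_def)

lemma card_box [simp]: "card (box a b c) = a * b * c"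
  by (simp add: box_def)

lemma hdist_triangle: "hdist u w \<le> hdist u v + hdist v w"
  by (cases u; cases v; cases w) auto

lemma hdist_eq_0 [simp]: "hdist u v = 0 \<longleftrightarrow> u = v"
  by (cases u; cases v) auto

lemma hdist_self [simp]: "hdist u u = 0"
  by simp

lemma hdist_le_3: "hdist u v \<le> 3"
  by (cases u; cases v) auto

lemma hdist_le_length:
  assumes "successively (\<lambda>u v. hdist u v = 1) p" "p \<noteq> []"
  shows "hdist (hd p) (last p) \<le> length p - 1"
  using assms
proof (induction p rule: induct_list012)
  case (3 u v p)
  then show ?case using hdist_triangle[of u "last (v # p)" v] by simp
qed auto

lemma length_geodesic: "geodesic p \<Longrightarrow> length p \<le> 4"
  unfolding geodesic_def using hdist_le_3[of "hd p" "last p"] by linarith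

lemma geodesic_cases:
  assumes "geodesic p"
  obtains u where "p = [u]" | u v where "p = [u, v]" | u v w where "p = [u, v, w]"
    | u v w t where "p = [u, v, w, t]"
proof -
  have "p \<noteq> []" "length p \<le> 4"
    using assms length_geodesic by (auto simp: geodesic_def)
  then consider "length p = 1" | "length p = 2" | "length p = 3" | "length p = 4"
    by (cases p) (auto simp: le_Suc_eq numeral_eq_Suc)
  then show thesis
    by cases (auto simp: length_Suc_conv numeral_eq_Suc intro: that)
qed

lemma distinct_geodesic:
  assumes "geodesic p"
  shows "distinct p"
proof -
  from assms show ?thesis
  proof (cases rule: geodesic_cases)
    case (4 u v w t)
    \<comment> \<open>The ends are at distance 3; \<open>u = w\<close> or \<open>v = t\<close> would
      bring them within distance 1.\<close>
    have "hdist u t \<le> hdist u w + hdist w t" "hdist u t \<le> hdist u v + hdist v t"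
      by (rule hdist_triangle)+
    with 4 assms show ?thesis by (auto simp: geodesic_def)
  qed (use assms in \<open>auto simp: geodesic_def\<close>)
qed

lemma geodesic_exists:
  assumes "u \<in> box a b c" "v \<in> box a b c"
  obtains p where "geodesic p" "set p \<subseteq> box a b c" "hd p = u" "last p = v"
proof -
  obtain x y z where u: "u = (x, y, z)" by (cases u)
  obtain x' y' z' where v: "v = (x', y', z')" by (cases v)
  \<comment> \<open>Coordinates change one at a time; \<open>remdups_adj\<close> drops the steps for
    coordinates that already agree.\<close>
  let ?p = "remdups_adj [(x, y, z), (x', y, z), (x', y', z), (x', y', z')]"
  show thesis
    by (rule that[of ?p]) (use assms u v in \<open>auto simp: geodesic_def\<close>)
qed

section \<open>Transfer between coordinate lists and triples\<close>

fun list_of_triple :: "nat \<times> nat \<times> nat \<Rightarrow> nat list" where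
  "list_of_triple (x, y, z) = [x, y, z]"

lemma inj_list_of_triple: "inj list_of_triple"
  by (rule injI) (auto elim!: list_of_triple.elims)

lemma verts_complete_product3: "complete_product_verts [a, b, c] = list_of_triple ` box a b c"
proof (intro equalityI subsetI)
  fix x
  assume "x \<in> complete_product_verts [a, b, c]"
  then have len: "length x = 3" and lt: "\<And>i. i < 3 \<Longrightarrow> x ! i < [a, b, c] ! i"
    by (auto simp: complete_product_verts_def)
  from len obtain i j k where "x = [i, j, k]"
    by (auto simp: length_Suc_conv numeral_eq_Suc)
  with lt[of 0] lt[of 1] lt[of 2] show "x \<in> list_of_triple ` box a b c"
    by (auto intro!: image_eqI[of _ _ "(i, j, k)"])
qed (auto simp: complete_product_verts_def less_Suc_eq)

lemma pverts_complete_product3 [simp]: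
  "pverts (complete_product [a, b, c]) = list_of_triple ` box a b c"
  by (simp add: complete_product_def verts_complete_product3)

text \<open>Brings the adjacency of \<open>complete_product\<close> into the form of
  \<open>hdist u v = 1\<close>.\<close>

lemma ex1_less_3:
  fixes P :: "nat \<Rightarrow> bool"
  shows
  "(\<exists>!i. i < 3 \<and> P i) \<longleftrightarrow> of_bool (P 0) + of_bool (P 1) + of_bool (P 2) = (1 :: nat)"
proof -
  have *: "i < 3 \<longleftrightarrow> i = 0 \<or> i = 1 \<or> i = 2" for i :: nat
    by auto
  have "(\<exists>!i. i < 3 \<and> P i) \<longleftrightarrow>
      P 0 \<and> \<not> P 1 \<and> \<not> P 2 \<or> \<not> P 0 \<and> P 1 \<and> \<not> P 2 \<or> \<not> P 0 \<and> \<not> P 1 \<and> P 2"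
    unfolding * Ex1_def conj_disj_distribR ex_disj_distrib imp_disjL all_conj_distrib imp_conjL
    by auto
  then show ?thesis
    by (auto simp: of_bool_def)
qed

lemma parcs_complete_product3:
  "(list_of_triple u, list_of_triple v) \<in> parcs (complete_product [a, b, c]) \<longleftrightarrow>
     u \<in> box a b c \<and> v \<in> box a b c \<and> hdist u v = 1"
proof -
  obtain x y z where u: "u = (x, y, z)" by (cases u)
  obtain x' y' z' where v: "v = (x', y', z')" by (cases v)
  have "(\<exists>!i. i < length [a, b, c] \<and> [x, y, z] ! i \<noteq> [x', y', z'] ! i) \<longleftrightarrow>
      (\<exists>!i. i < 3 \<and> [x, y, z] ! i \<noteq> [x', y', z'] ! i)"
    by (simp add: numeral_3_eq_3)
  also have "\<dots> \<longleftrightarrow> hdist u v = 1"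
    unfolding ex1_less_3 by (simp add: u v)
  finally have "(\<exists>!i. i < length [a, b, c] \<and> [x, y, z] ! i \<noteq> [x', y', z'] ! i) \<longleftrightarrow> hdist u v = 1" .
  then show ?thesis
    by (simp only: complete_product_def pair_pre_digraph.simps mem_Collect_eq prod.case
        verts_complete_product3 inj_image_mem_iff[OF inj_list_of_triple])
       (simp only: u v list_of_triple.simps)
qed

lemma vwalk_complete_product3:
  "vwalk (map list_of_triple p) (complete_product [a, b, c]) \<longleftrightarrow>
     p \<noteq> [] \<and> set p \<subseteq> box a b c \<and> successively (\<lambda>u v. hdist u v = 1) p"
proof (induction p rule: induct_list012)
  case (3 u v p)
  then show ?case
    by (auto simp: vwalk_def parcs_complete_product3 inj_image_mem_iff[OF inj_list_of_triple])
qed (auto simp: vwalk_def inj_image_mem_iff[OF inj_list_of_triple])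

lemma vwalk_complete_product3E:
  assumes "vwalk q (complete_product [a, b, c])"
  obtains p where "q = map list_of_triple p"
proof -
  have "q \<in> lists (range list_of_triple)"
    using assms by (auto simp: vwalk_def)
  then show thesis
    using that by (auto simp: lists_image)
qed

text \<open>An isometric path is no longer than the walk of Hamming length from
  \<open>geodesic_exists\<close>; conversely, \<open>hdist_le_length\<close> bounds every competitor
  of a geodesic from below.\<close>

lemma isometric_path_complete_product3:
  "isometric_path (complete_product [a, b, c]) (map list_of_triple p) \<longleftrightarrow>
     geodesic p \<and> set p \<subseteq> box a b c"
  (is "?L \<longleftrightarrow> ?R")
proof
  assume L: ?L
  then have p: "p \<noteq> []" "set p \<subseteq> box a b c" "successively (\<lambda>u v. hdist u v = 1) p"
    by (auto simp: isometric_path_def vpath_def vwalk_complete_product3)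
  then have "hd p \<in> box a b c" "last p \<in> box a b c"
    by auto
  then obtain q where q: "geodesic q" "set q \<subseteq> box a b c" "hd q = hd p" "last q = last p"
    by (rule geodesic_exists)
  then have "vpath (map list_of_triple q) (complete_product [a, b, c])"
    by (auto simp: vpath_def vwalk_complete_product3 geodesic_def distinct_geodesic
        distinct_map inj_on_subset[OF inj_list_of_triple])
  moreover have "q \<noteq> []"
    using q by (simp add: geodesic_def)
  ultimately have "length p - 1 \<le> length q - 1"
    using L p q by (auto simp: isometric_path_def hd_map last_map dest!: spec[of _ "map list_of_triple q"])
  with hdist_le_length[OF p(3,1)] p q show ?R
    by (auto simp: geodesic_def)
next
  assume R: ?R
  then have "vpath (map list_of_triple p) (complete_product [a, b, c])"
    by (auto simp: vpath_def vwalk_complete_product3 geodesic_def distinct_geodesic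
        distinct_map inj_on_subset[OF inj_list_of_triple])
  moreover have "length p - 1 \<le> length q - 1"
    if q: "vpath q (complete_product [a, b, c])" "hd q = hd (map list_of_triple p)"
      "last q = last (map list_of_triple p)" for q
  proof -
    from q obtain q' where q': "q = map list_of_triple q'"
      by (auto simp: vpath_def elim: vwalk_complete_product3E)
    with q have w: "q' \<noteq> []" "successively (\<lambda>u v. hdist u v = 1) q'"
      by (auto simp: vpath_def vwalk_complete_product3)
    have "hd q' = hd p" "last q' = last p"
      using q q' w R by (auto simp: hd_map last_map geodesic_def dest: injD[OF inj_list_of_triple])
    with hdist_le_length[OF w(2,1)] R q' show ?thesis
      by (simp add: geodesic_def)
  qed
  ultimately show ?L
    by (auto simp: isometric_path_def)
qed

lemma isometric_path_number_le:
  assumes "coverable a b c k"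
  shows "isometric_path_number (complete_product [a, b, c]) \<le> k"
proof -
  obtain ps where ps: "length ps = k" "\<forall>p\<in>set ps. geodesic p" "(\<Union>p\<in>set ps. set p) = box a b c"
    using assms by (auto simp: coverable_def)
  let ?P = "map list_of_triple ` set ps"
  have "isometric_path_cover (complete_product [a, b, c]) ?P"
    using ps(2) ps(3)[symmetric]
    by (auto simp: isometric_path_cover_def isometric_path_complete_product3)
  then have "isometric_path_number (complete_product [a, b, c]) \<le> card ?P"
    unfolding isometric_path_number_def by (intro Least_le) blast
  \<comment> \<open>The list may repeat a path, so only an inequality holds.\<close>
  also have "\<dots> \<le> k"
    using ps(1) card_image_le[of "set ps" "map list_of_triple"] card_length[of ps] by simp
  finally show ?thesis .
qed

lemma coverable_isometric_path_number:
  "coverable a b c (isometric_path_number (complete_product [a, b, c]))"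
proof -
  let ?G = "complete_product [a, b, c]"
  have "finite (verts ?G)"
    by simp
  then obtain P where P: "isometric_path_cover ?G P" "card P = isometric_path_number ?G"
    using isometric_path_number_attained by blast
  from P(1) have fin: "finite P" and iso: "\<And>p. p \<in> P \<Longrightarrow> isometric_path ?G p"
    and un: "(\<Union>p\<in>P. set p) = list_of_triple ` box a b c"
    by (auto simp: isometric_path_cover_def)
  have "\<exists>p'. p = map list_of_triple p'" if "p \<in> P" for p
    using iso[OF that] by (auto simp: isometric_path_def vpath_def elim: vwalk_complete_product3E)
  then obtain f where f: "\<And>p. p \<in> P \<Longrightarrow> p = map list_of_triple (f p)"
    by metis
  obtain qs where qs: "set qs = P" "distinct qs"
    using fin finite_distinct_list by blast
  have "geodesic (f p)" if "p \<in> P" for p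
    using iso[OF that] f[OF that] isometric_path_complete_product3 by metis
  moreover have "list_of_triple ` (\<Union>p\<in>P. set (f p)) = list_of_triple ` box a b c"
    unfolding un[symmetric] image_UN by (intro SUP_cong refl) (metis f set_map)
  then have "(\<Union>p\<in>P. set (f p)) = box a b c"
    by (simp add: inj_image_eq_iff[OF inj_list_of_triple])
  ultimately show ?thesis
    unfolding coverable_def using qs P(2)
    by (intro exI[of _ "map f qs"]) (auto simp: distinct_card[symmetric])
qed

section \<open>Lower bounds\<close>

lemma length_concat_geodesics: "\<forall>p\<in>set ps. geodesic p \<Longrightarrow> length (concat ps) \<le> 4 * length ps"
proof (induction ps)
  case (Cons p ps)
  then show ?case using length_geodesic[of p] by simp
qed simp

lemma coverable_lower_bound:
  assumes "coverable a b c k"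
  shows "a * b * c \<le> 4 * k"
proof -
  obtain ps where ps: "length ps = k" "\<forall>p\<in>set ps. geodesic p" "(\<Union>p\<in>set ps. set p) = box a b c"
    using assms by (auto simp: coverable_def)
  have "a * b * c = card (set (concat ps))"
    using ps(3) by simp
  also have "\<dots> \<le> length (concat ps)"
    by (rule card_length)
  also have "\<dots> \<le> 4 * k"
    using length_concat_geodesics[OF ps(2)] ps(1) by simp
  finally show ?thesis .
qed

section \<open>Parity obstruction in the boxes 2 x 2 x n\<close>

lemma hdist_eq_1:
  "hdist (a, b, c) (x, y, z) = 1 \<longleftrightarrow>
     a \<noteq> x \<and> b = y \<and> c = z \<or> a = x \<and> b \<noteq> y \<and> c = z \<or> a = x \<and> b = y \<and> c \<noteq> z"
  by auto

lemma hdist_eq_3: "hdist (a, b, c) (x, y, z) = 3 \<longleftrightarrow> a \<noteq> x \<and> b \<noteq> y \<and> c \<noteq> z"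
  by auto

text \<open>Three steps must change all three coordinates, so each sets a different one to its final
  value; the six pairs are the six orders.\<close>

lemma geodesic_length_4:
  assumes "geodesic p" "length p = 4"
  obtains x y z x' y' z' v w
  where "p = [(x, y, z), v, w, (x', y', z')]" "x \<noteq> x'" "y \<noteq> y'" "z \<noteq> z'"
    "(v, w) \<in> {((x', y, z), (x', y', z)), ((x, y', z), (x', y', z)), ((x', y, z), (x', y, z')),
      ((x, y', z), (x, y', z')), ((x, y, z'), (x', y, z')), ((x, y, z'), (x, y', z'))}"
proof -
  from assms obtain u v w t where p: "p = [u, v, w, t]"
    by (cases rule: geodesic_cases) auto
  obtain x y z where u: "u = (x, y, z)" by (cases u)
  obtain x' y' z' where t: "t = (x', y', z')" by (cases t)
  obtain v1 v2 v3 where v: "v = (v1, v2, v3)" by (cases v)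
  obtain w1 w2 w3 where w: "w = (w1, w2, w3)" by (cases w)
  have g: "hdist u v = 1" "hdist v w = 1" "hdist w t = 1" "hdist u t = 3"
    using assms(1) by (simp_all add: p geodesic_def del: hdist.simps)
  then have "x \<noteq> x'" "y \<noteq> y'" "z \<noteq> z'"
    unfolding u t hdist_eq_3 by blast+
  moreover from this g(1-3)
  have "(v, w) \<in> {((x', y, z), (x', y', z)), ((x, y', z), (x', y', z)), ((x', y, z), (x', y, z')),
      ((x, y', z), (x, y', z')), ((x, y, z'), (x', y, z')), ((x, y, z'), (x, y', z'))}"
    unfolding u v w t hdist_eq_1 by (elim disjE conjE) simp_all
  ultimately show thesis
    using p unfolding u t by (intro that[of x y z v w x' y' z'])
qed

text \<open>The vertex sets of four-vertex geodesics in 2 x 2 x n, where \<open>1 - a\<close> is the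
  other value of a coordinate. Up to reversal three orders of directions remain: the first two give
  type 3 + 1, the third type 2 + 2.\<close>

inductive bent :: "(nat \<times> nat \<times> nat) set \<Rightarrow> bool" where
  bent_xy: "bent {(a, b, z), (1 - a, b, z), (1 - a, 1 - b, z), (1 - a, 1 - b, z')}"
    if "a < 2" "b < 2" "z \<noteq> z'"
| bent_yx: "bent {(a, b, z), (a, 1 - b, z), (1 - a, 1 - b, z), (1 - a, 1 - b, z')}"
    if "a < 2" "b < 2" "z \<noteq> z'"
| bent_xzy: "bent {(a, b, z), (1 - a, b, z), (1 - a, b, z'), (1 - a, 1 - b, z')}"
    if "a < 2" "b < 2" "z \<noteq> z'"

lemma bent_geodesic:
  assumes "geodesic p" "length p = 4" "set p \<subseteq> box 2 2 n"
  shows "bent (set p)"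
proof -
  from assms(1,2) obtain x y z x' y' z' v w
    where p: "p = [(x, y, z), v, w, (x', y', z')]" and ne: "x \<noteq> x'" "y \<noteq> y'" and z: "z \<noteq> z'"
    and vw: "(v, w) \<in> {((x', y, z), (x', y', z)), ((x, y', z), (x', y', z)), ((x', y, z), (x', y, z')),
      ((x, y', z), (x, y', z')), ((x, y, z'), (x', y, z')), ((x, y, z'), (x, y', z'))}"
    by (rule geodesic_length_4)
  from p assms(3) have "x < 2" "y < 2" "x' < 2" "y' < 2"
    by auto
  with ne have *: "x' = 1 - x" "y' = 1 - y" "1 - (1 - x) = x" "1 - (1 - y) = y" "1 - x < 2" "1 - y < 2"
    and xy: "x < 2" "y < 2"
    by auto
  \<comment> \<open>The last three orders are reversals of the third, second and first, so they are
    read from the other end.\<close>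
  consider "p = [(x, y, z), (1 - x, y, z), (1 - x, 1 - y, z), (1 - x, 1 - y, z')]"
    | "p = [(x, y, z), (x, 1 - y, z), (1 - x, 1 - y, z), (1 - x, 1 - y, z')]"
    | "p = [(x, y, z), (1 - x, y, z), (1 - x, y, z'), (1 - x, 1 - y, z')]"
    | "p = [(x, y, z), (x, 1 - y, z), (x, 1 - y, z'), (1 - x, 1 - y, z')]"
    | "p = [(x, y, z), (x, y, z'), (1 - x, y, z'), (1 - x, 1 - y, z')]"
    | "p = [(x, y, z), (x, y, z'), (x, 1 - y, z'), (1 - x, 1 - y, z')]"
    using vw unfolding p *(1,2) by (elim insertE emptyE) simp_all
  then show ?thesis
  proof cases
    case 1
    then show ?thesis
      using bent_xy[of x y z z'] *(3-) xy z by (simp add: insert_commute)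
  next
    case 2
    then show ?thesis
      using bent_yx[of x y z z'] *(3-) xy z by (simp add: insert_commute)
  next
    case 3
    then show ?thesis
      using bent_xzy[of x y z z'] *(3-) xy z by (simp add: insert_commute)
  next
    case 4
    then show ?thesis
      using bent_xzy[of "1 - x" "1 - y" z' z] *(3-) xy z by (simp add: insert_commute)
  next
    case 5
    then show ?thesis
      using bent_yx[of "1 - x" "1 - y" z' z] *(3-) xy z by (simp add: insert_commute)
  next
    case 6
    then show ?thesis
      using bent_xy[of "1 - x" "1 - y" z' z] *(3-) xy z by (simp add: insert_commute)
  qed
qed

fun xflip :: "nat \<times> nat \<times> nat \<Rightarrow> nat \<times> nat \<times> nat" where
  "xflip (x, y, z) = (1 - x, y, z)"

fun yflip :: "nat \<times> nat \<times> nat \<Rightarrow> nat \<times> nat \<times> nat" where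
  "yflip (x, y, z) = (x, 1 - y, z)"

text \<open>On coordinates 0 and 1 this says that \<open>x + y\<close> is even, a parity that
  changes along every edge of a layer.\<close>

fun diag :: "nat \<times> nat \<times> nat \<Rightarrow> bool" where
  "diag (x, y, z) \<longleftrightarrow> x = y"

text \<open>The part of a path in a layer (fixed third coordinate) has one, two or three vertices:
  \<open>single\<close> detects the parts of size one, \<open>centre\<close> the middle vertices of the parts of size three,
  and \<open>xedge\<close> both vertices of a part of size two that runs in the first direction.\<close>

definition single :: "(nat \<times> nat \<times> nat) set \<Rightarrow> nat \<times> nat \<times> nat \<Rightarrow> bool" where
  "single A s \<longleftrightarrow> xflip s \<notin> A \<and> yflip s \<notin> A"

definition centre :: "(nat \<times> nat \<times> nat) set \<Rightarrow> nat \<times> nat \<times> nat \<Rightarrow> bool" where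
  "centre A s \<longleftrightarrow> xflip s \<in> A \<and> yflip s \<in> A"

definition xedge :: "(nat \<times> nat \<times> nat) set \<Rightarrow> nat \<times> nat \<times> nat \<Rightarrow> bool" where
  "xedge A s \<longleftrightarrow> xflip s \<in> A \<and> yflip s \<notin> A \<and> xflip (yflip s) \<notin> A"

text \<open>Type 3 + 1 has one centre, one single vertex of the other parity, and no x-edge; type 2
  + 2 has neither centre nor single vertex, and both vertices of its one x-edge are counted. So the
  third sum is 2 for either type. Diagonal vertices of a layer on the same path belong to a part of
  size three, hence the last claim.\<close>

lemma bent_counts:
  assumes "bent A"
  shows "(\<Sum>s\<in>A. of_bool (diag s \<and> single A s)) = (\<Sum>s\<in>A. of_bool (\<not> diag s \<and> centre A s) :: nat)" (is ?s1)
    and "(\<Sum>s\<in>A. of_bool (\<not> diag s \<and> single A s)) = (\<Sum>s\<in>A. of_bool (diag s \<and> centre A s) :: nat)" (is ?s2)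
    and "2 * (\<Sum>s\<in>A. of_bool (diag s \<and> centre A s)) + 2 * (\<Sum>s\<in>A. of_bool (\<not> diag s \<and> centre A s))
           + (\<Sum>s\<in>A. of_bool (xedge A s)) = (2 :: nat)" (is ?s3)
    and "card A = 4" (is ?s4)
    and "s \<in> A \<Longrightarrow> xflip (yflip s) \<in> A \<Longrightarrow> xflip s \<in> A \<longleftrightarrow> yflip s \<notin> A"
proof -
  have 01: "a = 0 \<or> a = 1" if "a < 2" for a :: nat
    using that by auto
  have "?s1 \<and> ?s2 \<and> ?s3 \<and> ?s4 \<and> (\<forall>s\<in>A. xflip (yflip s) \<in> A \<longrightarrow> (xflip s \<in> A \<longleftrightarrow> yflip s \<notin> A))"
    using assms
  proof cases
    case (bent_xy a b z z')
    show ?thesis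
      using 01[OF bent_xy(2)] 01[OF bent_xy(3)] bent_xy(4) unfolding bent_xy(1)
      by (elim disjE; hypsubst; simp add: single_def centre_def xedge_def bent_xy(4)[symmetric])
  next
    case (bent_yx a b z z')
    show ?thesis
      using 01[OF bent_yx(2)] 01[OF bent_yx(3)] bent_yx(4) unfolding bent_yx(1)
      by (elim disjE; hypsubst; simp add: single_def centre_def xedge_def bent_yx(4)[symmetric])
  next
    case (bent_xzy a b z z')
    show ?thesis
      using 01[OF bent_xzy(2)] 01[OF bent_xzy(3)] bent_xzy(4) unfolding bent_xzy(1)
      by (elim disjE; hypsubst; simp add: single_def centre_def xedge_def bent_xzy(4)[symmetric])
  qed
  then show ?s1 ?s2 ?s3 ?s4 "s \<in> A \<Longrightarrow> xflip (yflip s) \<in> A \<Longrightarrow> xflip s \<in> A \<longleftrightarrow> yflip s \<notin> A"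
    by blast+
qed

lemma sum_box_2_2:
  "(\<Sum>s\<in>box 2 2 n. f s) = (\<Sum>z<n. f (0, 0, z) + f (0, 1, z) + f (1, 0, z) + (f (1, 1, z) :: nat))"
proof -
  have "(\<Sum>s\<in>box 2 2 n. f s) = (\<Sum>x<2. \<Sum>y<2. \<Sum>z<n. f (x, y, z))"
    by (simp add: box_def sum.cartesian_product)
  then show ?thesis
    by (simp add: numeral_2_eq_2 sum.distrib)
qed

text \<open>\<open>pq\<close> says that the vertices \<open>p\<close> and \<open>q\<close> of the layer \<open>p = (0, 0)\<close>, \<open>q = (0, 1)\<close>, \<open>r = (1, 0)\<close>,
  \<open>t = (1, 1)\<close> lie on the same path.\<close>

lemma layer_counts:
  fixes pq pr pt qr qt rt :: bool
  assumes "pq \<and> pr \<longrightarrow> qr" "pq \<and> qr \<longrightarrow> pr" "pr \<and> qr \<longrightarrow> pq"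
    and "pq \<and> pt \<longrightarrow> qt" "pq \<and> qt \<longrightarrow> pt" "pt \<and> qt \<longrightarrow> pq"
    and "pr \<and> pt \<longrightarrow> rt" "pr \<and> rt \<longrightarrow> pt" "pt \<and> rt \<longrightarrow> pr"
    and "qr \<and> qt \<longrightarrow> rt" "qr \<and> rt \<longrightarrow> qt" "qt \<and> rt \<longrightarrow> qr"
    and "pt \<longrightarrow> pq \<or> pr" "pt \<longrightarrow> \<not> (pq \<and> pr)" "qr \<longrightarrow> pq \<or> qt" "qr \<longrightarrow> \<not> (pq \<and> qt)"
    and "ds = (of_bool (\<not> pr \<and> \<not> pq) + of_bool (\<not> qt \<and> \<not> rt) :: nat)"
    and "es = (of_bool (\<not> qt \<and> \<not> pq) + of_bool (\<not> pr \<and> \<not> rt) :: nat)"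
    and "dc = (of_bool (pr \<and> pq) + of_bool (qt \<and> rt) :: nat)"
    and "ec = (of_bool (qt \<and> pq) + of_bool (pr \<and> rt) :: nat)"
    and "xe = (of_bool (pr \<and> \<not> pq \<and> \<not> pt) + of_bool (qt \<and> \<not> pq \<and> \<not> qr)
            + of_bool (pr \<and> \<not> rt \<and> \<not> qr) + of_bool (qt \<and> \<not> rt \<and> \<not> pt) :: nat)"
  shows "dc + ec \<le> ds + es \<and> (dc + ec = ds + es \<longrightarrow> dc = ds \<and> 4 dvd xe)"
  \<comment> \<open>The possible layers are 3 + 1, with centre and single vertex opposite and so of
    equal parity; 2 + 2, where \<open>xe\<close> is 0 or 4; and 2 + 1 + 1 and 1 + 1 + 1 + 1, where
    the inequality is strict.\<close>
  unfolding assms(17-21)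
  by (insert assms(1-16), cases pq; cases pr; cases pt; cases qr; cases qt; cases rt; simp add: numeral_eq_Suc)

text \<open>Double counting: sums over all vertices are grouped by paths, using
  \<open>bent_counts\<close>, and by layers, using \<open>layer_counts\<close>.\<close>

lemma even_if_bent_partition:
  assumes un: "\<Union>\<A> = box 2 2 n" and disj: "disjoint \<A>" and bent: "\<And>A. A \<in> \<A> \<Longrightarrow> bent A"
  shows "even n"
proof -
  have "finite (\<Union>\<A>)"
    by (simp add: un)
  then have fin: "finite \<A>" "\<And>A. A \<in> \<A> \<Longrightarrow> finite A"
    by (auto dest: finite_UnionD intro: finite_subset[OF Union_upper])
  \<comment> \<open>The block containing \<open>s\<close>, obtained as the union of a family with
    one member.\<close>
  define own where "own s = \<Union>{A \<in> \<A>. s \<in> A}" for s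
  have own: "own s = A" if "A \<in> \<A>" "s \<in> A" for s A
  proof -
    have "{B \<in> \<A>. s \<in> B} = {A}"
      using that disj by (auto simp: pairwise_def disjnt_def)
    then show ?thesis by (simp add: own_def)
  qed
  have own_in: "own s \<in> \<A>" "s \<in> own s" if "s \<in> box 2 2 n" for s
    using that own unfolding un[symmetric] by (metis UnionE)+
  have own_eq: "t \<in> own s \<longleftrightarrow> own t = own s" if "s \<in> box 2 2 n" "t \<in> box 2 2 n" for s t
    using that own own_in by metis
  have sum_own: "(\<Sum>s\<in>box 2 2 n. W (own s) s) = (\<Sum>A\<in>\<A>. \<Sum>s\<in>A. W A s)" for W :: "_ \<Rightarrow> _ \<Rightarrow> nat"
  proof -
    have "(\<Sum>s\<in>box 2 2 n. W (own s) s) = (\<Sum>A\<in>\<A>. \<Sum>s\<in>A. W (own s) s)"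
      unfolding un[symmetric]
      using fin disj by (subst sum.Union_disjoint) (auto simp: pairwise_def disjnt_def)
    also have "\<dots> = (\<Sum>A\<in>\<A>. \<Sum>s\<in>A. W A s)"
      by (rule sum.cong[OF refl]) (simp add: own)
    finally show ?thesis .
  qed
  \<comment> \<open>The first letter says on (\<open>d\<close>) or off (\<open>e\<close>) the
    diagonal, the second single (\<open>s\<close>) or centre (\<open>c\<close>); \<open>xe\<close>
    marks vertices of x-edges.\<close>
  define ds where "ds A s = (of_bool (diag s \<and> single A s) :: nat)" for A s
  define es where "es A s = (of_bool (\<not> diag s \<and> single A s) :: nat)" for A s
  define dc where "dc A s = (of_bool (diag s \<and> centre A s) :: nat)" for A s
  define ec where "ec A s = (of_bool (\<not> diag s \<and> centre A s) :: nat)" for A s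
  define xe where "xe A s = (of_bool (xedge A s) :: nat)" for A s
  \<comment> \<open>The total of \<open>W\<close> over the four vertices of layer \<open>z\<close>,
    each judged within its own path.\<close>
  define lay where "lay W z = W (own (0, 0, z)) (0, 0, z) + W (own (0, 1, z)) (0, 1, z)
    + W (own (1, 0, z)) (1, 0, z) + W (own (1, 1, z)) (1, 1, z)"
    for W :: "(nat \<times> nat \<times> nat) set \<Rightarrow> nat \<times> nat \<times> nat \<Rightarrow> nat" and z
  have tot: "(\<Sum>z<n. lay W z) = (\<Sum>A\<in>\<A>. \<Sum>s\<in>A. W A s)" for W
    unfolding sum_own[symmetric] sum_box_2_2 lay_def ..
  note bc = bent_counts[OF bent]
  \<comment> \<open>Along paths the parities of single vertex and centre are opposite, so
    \<open>ds\<close> is matched with \<open>ec\<close> and \<open>es\<close> with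
    \<open>dc\<close>.\<close>
  have T1: "(\<Sum>z<n. lay ds z) = (\<Sum>z<n. lay ec z)"
    unfolding tot ds_def[abs_def] ec_def[abs_def] by (rule sum.cong[OF refl]) (simp only: bc(1))
  have T2: "(\<Sum>z<n. lay es z) = (\<Sum>z<n. lay dc z)"
    unfolding tot es_def[abs_def] dc_def[abs_def] by (rule sum.cong[OF refl]) (simp only: bc(2))
  have "2 * (\<Sum>z<n. lay dc z) + 2 * (\<Sum>z<n. lay ec z) + (\<Sum>z<n. lay xe z)
      = (\<Sum>A\<in>\<A>. 2 * (\<Sum>s\<in>A. dc A s) + 2 * (\<Sum>s\<in>A. ec A s) + (\<Sum>s\<in>A. xe A s))"
    by (simp only: tot sum.distrib sum_distrib_left)
  also have "\<dots> = (\<Sum>A\<in>\<A>. 2)"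
    unfolding dc_def[abs_def] ec_def[abs_def] xe_def[abs_def]
    by (rule sum.cong[OF refl]) (simp only: bc(3))
  finally have T3: "2 * (\<Sum>z<n. lay dc z) + 2 * (\<Sum>z<n. lay ec z) + (\<Sum>z<n. lay xe z) = 2 * card \<A>"
    by simp
  have "card (\<Union>\<A>) = (\<Sum>A\<in>\<A>. card A)"
    using fin disj by (intro card_Union_disjoint) auto
  then have cardA: "card \<A> = n"
    by (simp add: un bc(4))
  have L: "lay dc z + lay ec z \<le> lay ds z + lay es z \<and>
      (lay dc z + lay ec z = lay ds z + lay es z \<longrightarrow> lay dc z = lay ds z \<and> 4 dvd lay xe z)"
    if "z < n" for z
  proof -
    let ?p = "own (0, 0, z)" and ?q = "own (0, 1, z)" and ?r = "own (1, 0, z)" and ?t = "own (1, 1, z)"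
    have b: "(0, 0, z) \<in> box 2 2 n" "(0, 1, z) \<in> box 2 2 n" "(1, 0, z) \<in> box 2 2 n" "(1, 1, z) \<in> box 2 2 n"
      using that by auto
    have o:
      "(0, 1, z) \<in> ?p \<longleftrightarrow> ?p = ?q" "(0, 0, z) \<in> ?q \<longleftrightarrow> ?p = ?q"
      "(1, 0, z) \<in> ?p \<longleftrightarrow> ?p = ?r" "(0, 0, z) \<in> ?r \<longleftrightarrow> ?p = ?r"
      "(1, 1, z) \<in> ?p \<longleftrightarrow> ?p = ?t" "(0, 0, z) \<in> ?t \<longleftrightarrow> ?p = ?t"
      "(1, 0, z) \<in> ?q \<longleftrightarrow> ?q = ?r" "(0, 1, z) \<in> ?r \<longleftrightarrow> ?q = ?r"
      "(1, 1, z) \<in> ?q \<longleftrightarrow> ?q = ?t" "(0, 1, z) \<in> ?t \<longleftrightarrow> ?q = ?t"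
      "(1, 1, z) \<in> ?r \<longleftrightarrow> ?r = ?t" "(1, 0, z) \<in> ?t \<longleftrightarrow> ?r = ?t"
      using own_eq b by metis+
    have "(1, 1, z) \<in> ?p \<Longrightarrow> (1, 0, z) \<in> ?p \<longleftrightarrow> (0, 1, z) \<notin> ?p"
      "(1, 0, z) \<in> ?q \<Longrightarrow> (1, 1, z) \<in> ?q \<longleftrightarrow> (0, 0, z) \<notin> ?q"
      using bc(5)[OF own_in[OF b(1)]] bc(5)[OF own_in[OF b(2)]] by simp_all
    then have diagonals: "?p = ?t \<Longrightarrow> ?p = ?r \<longleftrightarrow> ?p \<noteq> ?q" "?q = ?r \<Longrightarrow> ?q = ?t \<longleftrightarrow> ?p \<noteq> ?q"
      unfolding o by blast+
    have lays:
      "lay ds z = of_bool ((1, 0, z) \<notin> ?p \<and> (0, 1, z) \<notin> ?p) + of_bool ((0, 1, z) \<notin> ?t \<and> (1, 0, z) \<notin> ?t)"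
      "lay es z = of_bool ((1, 1, z) \<notin> ?q \<and> (0, 0, z) \<notin> ?q) + of_bool ((0, 0, z) \<notin> ?r \<and> (1, 1, z) \<notin> ?r)"
      "lay dc z = of_bool ((1, 0, z) \<in> ?p \<and> (0, 1, z) \<in> ?p) + of_bool ((0, 1, z) \<in> ?t \<and> (1, 0, z) \<in> ?t)"
      "lay ec z = of_bool ((1, 1, z) \<in> ?q \<and> (0, 0, z) \<in> ?q) + of_bool ((0, 0, z) \<in> ?r \<and> (1, 1, z) \<in> ?r)"
      "lay xe z = of_bool ((1, 0, z) \<in> ?p \<and> (0, 1, z) \<notin> ?p \<and> (1, 1, z) \<notin> ?p)
        + of_bool ((1, 1, z) \<in> ?q \<and> (0, 0, z) \<notin> ?q \<and> (1, 0, z) \<notin> ?q)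
        + of_bool ((0, 0, z) \<in> ?r \<and> (1, 1, z) \<notin> ?r \<and> (0, 1, z) \<notin> ?r)
        + of_bool ((0, 1, z) \<in> ?t \<and> (1, 0, z) \<notin> ?t \<and> (0, 0, z) \<notin> ?t)"
      by (simp_all add: lay_def ds_def es_def dc_def ec_def xe_def single_def centre_def xedge_def)
    show ?thesis
      by (rule layer_counts[OF _ _ _ _ _ _ _ _ _ _ _ _ _ _ _ _ lays[unfolded o]])
         (use diagonals in metis)+
  qed
  \<comment> \<open>The totals agree, so the inequality of \<open>L\<close> is tight in every layer,
    and its second part applies everywhere.\<close>
  have "(\<Sum>z<n. lay dc z + lay ec z) = (\<Sum>z<n. lay ds z + lay es z)"
    using T1 T2 by (simp add: sum.distrib)
  then have eq: "lay dc z + lay ec z = lay ds z + lay es z" if "z < n" for z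
    by (rule sum_mono_inv) (use that L in auto)
  then have "(\<Sum>z<n. lay dc z) = (\<Sum>z<n. lay ds z)" and "4 dvd (\<Sum>z<n. lay xe z)"
    using L by (auto intro: sum.cong dvd_sum)
  \<comment> \<open>Layers give equal totals of \<open>dc\<close> and \<open>ds\<close>, paths of
    \<open>ds\<close> and \<open>ec\<close>. So in \<open>T3\<close> the two centre totals coincide,
    and \<open>2 * n\<close> is a multiple of 4.\<close>
  then obtain k where "(\<Sum>z<n. lay xe z) = 4 * k" "(\<Sum>z<n. lay dc z) = (\<Sum>z<n. lay ec z)"
    using T1 by auto
  with T3 cardA have "n = 2 * ((\<Sum>z<n. lay ec z) + k)"
    by simp
  then show ?thesis
    by (metis dvd_triv_left)
qed

lemma length_concat_eq_bound:
  assumes "\<forall>p\<in>set ps. geodesic p" "length (concat ps) = 4 * length ps" "p \<in> set ps"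
  shows "length p = 4"
  using assms
proof (induction ps)
  case (Cons q ps)
  then show ?case
    using length_geodesic[of q] length_concat_geodesics[of ps] by auto
qed simp

lemma coverable_2_2_even:
  assumes "coverable 2 2 n n"
  shows "even n"
proof -
  obtain ps where ps: "length ps = n" "\<forall>p\<in>set ps. geodesic p" "(\<Union>p\<in>set ps. set p) = box 2 2 n"
    using assms by (auto simp: coverable_def)
  \<comment> \<open>\<open>n\<close> paths of at most four vertices cover \<open>4 * n\<close>
    vertices, so nothing is wasted: all paths have four vertices and are disjoint.\<close>
  have "card (set (concat ps)) = 4 * n"
    using ps(3) by simp
  then have len: "length (concat ps) = 4 * n" and "distinct (concat ps)"
    using length_concat_geodesics[OF ps(2)] ps(1) card_length[of "concat ps"]
    by (auto intro: card_distinct)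
  then have "disjoint (set ` set ps)"
    by (auto simp: distinct_concat_iff pairwise_def disjnt_def)
  moreover have "bent (set p)" if "p \<in> set ps" for p
    using that ps len by (intro bent_geodesic[of _ n]) (auto intro: length_concat_eq_bound)
  ultimately show ?thesis
    using even_if_bent_partition[of "set ` set ps" n] ps(3) by auto
qed

section \<open>Upper bounds\<close>

text \<open>The second cover is shifted by \<open>a\<close> in the first coordinate, which keeps
  Hamming distances, and joined to the first.\<close>

lemma coverable_add:
  assumes "coverable a b c k" "coverable a' b c l"
  shows "coverable (a + a') b c (k + l)"
proof -
  obtain ps where ps: "length ps = k" "\<forall>p\<in>set ps. geodesic p" "(\<Union>p\<in>set ps. set p) = box a b c"
    using assms(1) by (auto simp: coverable_def)
  obtain qs where qs: "length qs = l" "\<forall>p\<in>set qs. geodesic p" "(\<Union>p\<in>set qs. set p) = box a' b c"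
    using assms(2) by (auto simp: coverable_def)
  define sh where "sh = (\<lambda>(x, y, z). (a + x, y, z) :: nat \<times> nat \<times> nat)"
  have sh: "hdist (sh u) (sh v) = hdist u v" for u v
    by (cases u; cases v) (simp add: sh_def)
  have "geodesic (map sh p)" if "geodesic p" for p
    using that by (auto simp: geodesic_def successively_map hd_map last_map sh)
  moreover have "sh ` box a' b c \<union> box a b c = box (a + a') b c"
  proof (intro equalityI subsetI)
    fix s
    assume s: "s \<in> box (a + a') b c"
    obtain x y z where xyz: "s = (x, y, z)" by (cases s)
    show "s \<in> sh ` box a' b c \<union> box a b c"
    proof (cases "x < a")
      case False
      with s xyz have "s = sh (x - a, y, z)" "(x - a, y, z) \<in> box a' b c"
        by (auto simp: sh_def)
      then show ?thesis by blast
    qed (use s xyz in simp)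
  qed (auto simp: sh_def)
  ultimately show ?thesis
    unfolding coverable_def using ps qs
    by (intro exI[of _ "map (map sh) qs @ ps"]) (auto simp: image_UN[symmetric])
qed

lemma coverable_image:
  assumes "coverable a b c k" "\<And>u v. hdist (f u) (f v) = hdist u v" "f ` box a b c = box a' b' c'"
  shows "coverable a' b' c' k"
proof -
  obtain ps where ps: "length ps = k" "\<forall>p\<in>set ps. geodesic p" "(\<Union>p\<in>set ps. set p) = box a b c"
    using assms(1) by (auto simp: coverable_def)
  have "geodesic (map f p)" if "geodesic p" for p
    using that by (auto simp: geodesic_def successively_map hd_map last_map assms(2))
  moreover have "(\<Union>p\<in>set ps. f ` set p) = box a' b' c'"
    unfolding assms(3)[symmetric] ps(3)[symmetric] by blast
  ultimately show ?thesis
    unfolding coverable_def using ps(1,2)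
    by (intro exI[of _ "map (map f) ps"]) auto
qed

lemma coverable_swap12: "coverable a b c k \<Longrightarrow> coverable b a c k"
  by (erule coverable_image[where f = "\<lambda>(x, y, z). (y, x, z)"]) (auto simp: box_def image_iff)

lemma coverable_swap23: "coverable a b c k \<Longrightarrow> coverable a c b k"
  by (erule coverable_image[where f = "\<lambda>(x, y, z). (x, z, y)"]) (auto simp: box_def image_iff)

text \<open>Reduces an explicit cover to finite checks that can be decided by evaluation.\<close>

lemma coverableI_check:
  assumes "list_all geodesic ps" "length ps = k"
    and "list_all (\<lambda>(x, y, z). x < a \<and> y < b \<and> z < c) (concat ps)"
    and "list_all (\<lambda>s. s \<in> set (concat ps)) (List.product [0..<a] (List.product [0..<b] [0..<c]))"
  shows "coverable a b c k"
proof -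
  have "set (concat ps) \<subseteq> box a b c"
    using assms(3) by (fastforce simp: list_all_iff box_def)
  moreover have "box a b c \<subseteq> set (concat ps)"
    using assms(4) by (auto simp: list_all_iff box_def)
  ultimately show ?thesis
    using assms(1,2) by (auto simp: coverable_def list_all_iff intro!: exI[of _ ps])
qed

section \<open>Explicit covers of small boxes\<close>

lemma coverable_2_2_2: "coverable 2 2 2 2"
  by (rule coverableI_check[of
    "[[(0,1,0), (0,0,0), (0,0,1), (1,0,1)],
        [(0,1,1), (1,1,1), (1,1,0), (1,0,0)]]"]) code_simp+

lemma coverable_2_4_3: "coverable 2 4 3 6"
  by (rule coverableI_check[of
    "[[(0,0,1), (0,0,0), (1,0,0), (1,3,0)],
        [(0,1,0), (1,1,0), (1,2,0), (1,2,2)],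
        [(0,2,2), (0,1,2), (0,1,1), (1,1,1)],
        [(0,3,0), (0,2,0), (0,2,1), (1,2,1)],
        [(0,3,1), (1,3,1), (1,3,2), (1,1,2)],
        [(0,3,2), (0,0,2), (1,0,2), (1,0,1)]]"]) code_simp+

lemma coverable_2_6_3: "coverable 2 6 3 9"
  by (rule coverableI_check[of
    "[[(0,0,2), (1,0,2), (1,0,1), (1,4,1)],
        [(0,1,0), (0,1,2), (0,4,2), (1,4,2)],
        [(0,1,1), (0,4,1), (0,4,0), (1,4,0)],
        [(0,2,0), (1,2,0), (1,1,0), (1,1,1)],
        [(0,2,1), (0,0,1), (0,0,0), (1,0,0)],
        [(0,2,2), (1,2,2), (1,2,1), (1,5,1)],
        [(0,3,0), (0,3,2), (1,3,2), (1,1,2)],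
        [(0,3,1), (0,5,1), (0,5,2), (1,5,2)],
        [(0,5,0), (1,5,0), (1,3,0), (1,3,1)]]"]) code_simp+

lemma coverable_4_3_3: "coverable 4 3 3 9"
  by (rule coverableI_check[of
    "[[(0,0,0), (3,0,0), (3,0,2), (3,2,2)],
        [(0,0,1), (0,0,2), (1,0,2), (1,2,2)],
        [(0,1,1), (0,1,0), (0,2,0), (1,2,0)],
        [(0,1,2), (0,2,2), (0,2,1), (2,2,1)],
        [(1,0,1), (1,0,0), (1,1,0), (3,1,0)],
        [(1,1,2), (1,1,1), (1,2,1), (3,2,1)],
        [(2,0,2), (2,0,0), (2,2,0), (3,2,0)],
        [(2,1,0), (2,1,1), (2,0,1), (3,0,1)],
        [(2,2,2), (2,1,2), (3,1,2), (3,1,1)]]"]) code_simp+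

text \<open>From here through \<open>coverable_3_5_5\<close> the volume is not a multiple of 4, and
  the number of paths is a quarter of it rounded up; in the preceding boxes it is exactly a
  quarter.\<close>

lemma coverable_2_3_3: "coverable 2 3 3 5"
  by (rule coverableI_check[of
    "[[(0,0,0), (1,0,0), (1,1,0), (1,1,1)],
        [(0,0,1), (1,0,1), (1,2,1), (1,2,0)],
        [(0,0,2), (1,0,2)],
        [(0,1,1), (0,2,1), (0,2,2), (1,2,2)],
        [(0,2,0), (0,1,0), (0,1,2), (1,1,2)]]"]) code_simp+

lemma coverable_2_3_5: "coverable 2 3 5 8"
  by (rule coverableI_check[of
    "[[(0,0,0), (0,1,0), (1,1,0), (1,1,4)],
        [(0,0,3), (0,0,4), (1,0,4), (1,2,4)],
        [(0,1,1), (0,0,1), (1,0,1), (1,0,0)],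
        [(0,1,3), (0,2,3), (1,2,3), (1,2,0)],
        [(0,1,4), (0,1,2), (1,1,2), (1,2,2)],
        [(0,2,0), (0,2,1), (1,2,1), (1,1,1)],
        [(0,2,4), (0,2,2), (0,0,2), (1,0,2)],
        [(1,0,3), (1,1,3)]]"]) code_simp+

lemma coverable_2_5_5: "coverable 2 5 5 13"
  by (rule coverableI_check[of
    "[[(0,0,2), (0,0,0), (0,4,0), (1,4,0)],
        [(0,0,3), (0,0,1), (1,0,1), (1,2,1)],
        [(0,0,4), (0,1,4), (1,1,4), (1,1,1)],
        [(0,1,2), (1,1,2), (1,3,2), (1,3,4)],
        [(0,2,1), (0,1,1), (0,1,0), (1,1,0)],
        [(0,2,4), (1,2,4), (1,2,2), (1,4,2)],
        [(0,3,0), (1,3,0), (1,0,0), (1,0,3)],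
        [(0,3,1), (0,3,3), (0,2,3), (1,2,3)],
        [(0,3,2), (0,2,2), (0,2,0), (1,2,0)],
        [(0,3,4), (0,4,4), (1,4,4), (1,4,3)],
        [(0,4,1), (1,4,1), (1,3,1), (1,3,3)],
        [(0,4,2), (0,4,3), (0,1,3), (1,1,3)],
        [(1,0,2), (1,0,4)]]"]) code_simp+

lemma coverable_3_3_3: "coverable 3 3 3 7"
  by (rule coverableI_check[of
    "[[(0,0,0), (0,1,0), (2,1,0), (2,1,1)],
        [(0,0,1), (0,0,2), (0,1,2), (1,1,2)],
        [(0,1,1), (1,1,1), (1,1,0), (1,0,0)],
        [(0,2,0), (2,2,0), (2,0,0)],
        [(0,2,2), (0,2,1), (1,2,1), (1,0,1)],
        [(1,0,2), (2,0,2), (2,0,1), (2,2,1)],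
        [(1,2,0), (1,2,2), (2,2,2), (2,1,2)]]"]) code_simp+

lemma coverable_3_5_5: "coverable 3 5 5 19"
  by (rule coverableI_check[of
    "[[(0,0,1), (0,1,1), (2,1,1), (2,1,2)],
        [(0,0,3), (1,0,3), (1,4,3), (1,4,1)],
        [(0,1,0), (0,4,0), (0,4,3), (2,4,3)],
        [(0,2,0), (0,2,3), (0,1,3), (2,1,3)],
        [(0,2,1), (1,2,1), (1,2,2), (1,0,2)],
        [(0,2,2), (0,1,2), (0,1,4), (2,1,4)],
        [(0,2,4), (1,2,4), (1,1,4), (1,1,2)],
        [(0,3,0), (0,0,0), (0,0,2), (2,0,2)],
        [(0,3,4), (0,3,2), (0,4,2), (1,4,2)],
        [(0,4,1), (0,3,1), (0,3,3), (2,3,3)],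
        [(0,4,4), (0,0,4), (1,0,4), (1,0,1)],
        [(1,0,0), (1,4,0), (2,4,0), (2,4,2)],
        [(1,1,1), (1,3,1), (2,3,1), (2,3,0)],
        [(1,1,3), (1,1,0), (2,1,0)],
        [(1,2,0), (2,2,0), (2,2,1), (2,4,1)],
        [(1,2,3), (2,2,3), (2,0,3), (2,0,1)],
        [(1,3,0), (1,3,4), (2,3,4), (2,2,4)],
        [(1,3,3), (1,3,2), (2,3,2), (2,2,2)],
        [(1,4,4), (2,4,4), (2,0,4), (2,0,0)]]"]) code_simp+

text \<open>One path above the volume bound, as \<open>coverable_2_2_even\<close> excludes three
  paths; this starts the exceptional family.\<close>

lemma coverable_2_2_3: "coverable 2 2 3 4"
  by (rule coverableI_check[of
    "[[(0,0,0), (1,0,0), (1,1,0), (1,1,1)],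
     [(0,1,0), (0,1,1), (0,0,1), (1,0,1)],
     [(0,0,2), (1,0,2), (1,1,2)],
     [(0,1,2)]]"]) code_simp+

section \<open>Boxes that attain the volume bound\<close>

text \<open>The number of paths is the volume divided by 4 and rounded up.\<close>

definition efficient :: "nat \<Rightarrow> nat \<Rightarrow> nat \<Rightarrow> bool" where
  "efficient a b c \<longleftrightarrow> coverable a b c ((a * b * c + 3) div 4)"

definition exceptional :: "nat \<Rightarrow> nat \<Rightarrow> nat \<Rightarrow> bool" where
  "exceptional a b c \<longleftrightarrow> a = 2 \<and> b = 2 \<and> odd c \<or> a = 2 \<and> c = 2 \<and> odd b \<or> b = 2 \<and> c = 2 \<and> odd a"

lemma efficient_swap12: "efficient a b c \<Longrightarrow> efficient b a c"
  unfolding efficient_def by (drule coverable_swap12) (simp add: mult_ac)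

lemma efficient_swap23: "efficient a b c \<Longrightarrow> efficient a c b"
  unfolding efficient_def by (drule coverable_swap23) (simp add: mult_ac)

lemma efficient_rotate: "efficient a b c \<Longrightarrow> efficient b c a"
  by (rule efficient_swap23[OF efficient_swap12])

text \<open>When one volume is a multiple of 4, its quarter is exact and the rounded quarters add
  up.\<close>

lemma efficient_add:
  assumes "4 dvd a * b * c" "efficient a b c" "efficient a' b c"
  shows "efficient (a + a') b c"
proof -
  obtain m where m: "a * b * c = 4 * m"
    using assms(1) by (elim dvdE)
  have e: "(a + a') * b * c = 4 * m + a' * b * c"
    unfolding m[symmetric] by (simp add: algebra_simps)
  have "(a * b * c + 3) div 4 + (a' * b * c + 3) div 4 = ((a + a') * b * c + 3) div 4"
    unfolding e m by simp
  with coverable_add[OF assms(2,3)[unfolded efficient_def]] show ?thesis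
    unfolding efficient_def by simp
qed

lemma efficient_add3:
  assumes "4 dvd a * b * c" "efficient a b c" "efficient a b c'"
  shows "efficient a b (c + c')"
proof -
  have "efficient (c + c') a b"
    using efficient_add[OF _ efficient_rotate[OF efficient_rotate] efficient_rotate[OF efficient_rotate]]
      assms by (simp add: mult_ac)
  then show ?thesis by (rule efficient_rotate)
qed

text \<open>Slabs of thickness 2 with exact covers are stacked on a base of thickness 2 or 3,
  according to the parity of \<open>n\<close>.\<close>

lemma efficient_step2:
  assumes "4 dvd a * b * 2" "efficient a b 2" "efficient a b 3" "n \<ge> 2"
  shows "efficient a b n"
  using assms(4)
proof (induction n rule: less_induct)
  case (less n)
  consider "n = 2" | "n = 3" | "n \<ge> 4"
    using less.prems by linarith
  then show ?case
  proof cases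
    case 3
    then have "efficient a b (n - 2)"
      by (intro less.IH) auto
    with assms have "efficient a b (2 + (n - 2))"
      by (intro efficient_add3)
    with 3 show ?thesis by (simp del: add_2_eq_Suc)
  qed (use assms in auto)
qed

lemma efficientI: "coverable a b c k \<Longrightarrow> (a * b * c + 3) div 4 = k \<Longrightarrow> efficient a b c"
  by (simp add: efficient_def)

lemma efficient_2_2_2: "efficient 2 2 2"
  using coverable_2_2_2 by (rule efficientI) simp

lemma efficient_2_2_4: "efficient 2 2 4"
  using efficient_add3[OF _ efficient_2_2_2 efficient_2_2_2] by simp

lemma efficient_2_2_6: "efficient 2 2 6"
  using efficient_add3[OF _ efficient_2_2_2 efficient_2_2_4] by simp

lemma efficient_2_4:
  assumes "n \<ge> 2"
  shows "efficient 2 4 n"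
proof (rule efficient_step2)
  show "efficient 2 4 2"
    using efficient_2_2_4 by (rule efficient_swap23)
  show "efficient 2 4 3"
    using coverable_2_4_3 by (rule efficientI) simp
qed (use assms in auto)

lemma efficient_2_6:
  assumes "n \<ge> 2"
  shows "efficient 2 6 n"
proof (rule efficient_step2)
  show "efficient 2 6 2"
    using efficient_2_2_6 by (rule efficient_swap23)
  show "efficient 2 6 3"
    using coverable_2_6_3 by (rule efficientI) simp
qed (use assms in auto)

text \<open>Supplies the slabs that lower a coordinate by 4. Steps of 2 are taken first in one free
  coordinate, with the other equal to 3, then in the other.\<close>

lemma efficient_4:
  assumes "m \<ge> 2" "n \<ge> 2"
  shows "efficient 4 m n"
proof -
  have 2: "efficient 4 k 2" if "k \<ge> 2" for k
    using efficient_2_4[OF that] by (rule efficient_rotate)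
  have 3: "efficient 4 3 k" if "k \<ge> 2" for k
  proof (rule efficient_step2)
    show "efficient 4 3 3"
      using coverable_4_3_3 by (rule efficientI) simp
  qed (use that 2[of 3] in auto)
  show ?thesis
  proof (rule efficient_step2)
    show "efficient 4 m 3"
      using 3[OF assms(1)] by (rule efficient_swap23)
  qed (use assms 2 in auto)
qed

lemma efficient_3_3_5: "efficient 3 3 5"
proof -
  \<comment> \<open>Neither volume is a multiple of 4, but the wasted places, 1 and 2, add up to
    less than 4, so the sum is still optimal. The same happens for 5 x 5 x 5.\<close>
  have "coverable (3 + 2) 3 3 (7 + 5)"
    using coverable_3_3_3 coverable_2_3_3 by (rule coverable_add)
  then have "efficient 5 3 3"
    by (intro efficientI[of _ _ _ 12]) simp_all
  then show ?thesis by (rule efficient_rotate)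
qed

lemma efficient_5_5_5: "efficient 5 5 5"
  using coverable_add[OF coverable_3_5_5 coverable_2_5_5] by (intro efficientI[of _ _ _ 32]) simp_all

lemma efficient_small:
  assumes "a \<in> {2, 3, 5}" "b \<in> {2, 3, 5}" "c \<in> {2, 3, 5}" "\<not> exceptional a b c"
  shows "efficient a b c"
proof -
  have e: "efficient 2 3 3" "efficient 2 3 5" "efficient 2 5 5" "efficient 3 3 3" "efficient 3 5 5"
    by (rule efficientI, fact coverable_2_3_3 coverable_2_3_5 coverable_2_5_5 coverable_3_3_3
        coverable_3_5_5, simp)+
  note e = e efficient_2_2_2 efficient_3_3_5 efficient_5_5_5
  \<comment> \<open>Rotations and one transposition produce all orders of the three sides.\<close>
  note e' = e e[THEN efficient_rotate] e[THEN efficient_rotate, THEN efficient_rotate]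
  note e'' = e' e'[THEN efficient_swap23]
  show ?thesis
    using assms by (elim insertE emptyE; hypsubst) (simp_all add: e'' exceptional_def)
qed

lemma efficient_if_ge_6:
  assumes IH: "\<not> exceptional a b (c - 4) \<Longrightarrow> efficient a b (c - 4)"
    and "a \<ge> 2" "b \<ge> 2" "c \<ge> 6" "\<not> exceptional a b c"
  shows "efficient a b c"
proof (cases "exceptional a b (c - 4)")
  case True
  \<comment> \<open>Subtracting 4 keeps the parity of \<open>c\<close>, so the smaller box can
    become exceptional only through \<open>c - 4 = 2\<close>; the sides 2 and 6 are then handled by
    \<open>efficient_2_6\<close>.\<close>
  with assms have "c = 6" and "a = 2 \<or> b = 2"
    by (auto simp: exceptional_def)
  moreover have "efficient 2 b 6" "efficient a 2 6"
    using efficient_swap23[OF efficient_2_6[of b]] efficient_rotate[OF efficient_rotate[OF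
      efficient_2_6[of a]]] assms by auto
  ultimately show ?thesis by auto
next
  case False
  have "efficient 4 a b"
    using assms by (intro efficient_4)
  then have "efficient a b (4 + (c - 4))"
    using IH[OF False] by (intro efficient_add3) (simp_all add: efficient_rotate)
  with assms show ?thesis by simp
qed

lemma exceptional_rotate: "exceptional b c a = exceptional a b c"
  by (auto simp: exceptional_def)

text \<open>Sides of at least 6 are lowered by 4. Otherwise some side is 4, or all sides lie in {2,
  3, 5}.\<close>

lemma efficient_if_not_exceptional:
  assumes "a \<ge> 2" "b \<ge> 2" "c \<ge> 2" "\<not> exceptional a b c"
  shows "efficient a b c"
  using assms
proof (induction "a + b + c" arbitrary: a b c rule: less_induct)
  case less
  consider "a \<ge> 6" | "b \<ge> 6" | "c \<ge> 6" | "a = 4 \<or> b = 4 \<or> c = 4"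
    | "a \<in> {2, 3, 5} \<and> b \<in> {2, 3, 5} \<and> c \<in> {2, 3, 5}"
    using less.prems by force
  then show ?case
  proof cases
    case 1
    have "efficient b c a"
    proof (rule efficient_if_ge_6)
      show "efficient b c (a - 4)" if "\<not> exceptional b c (a - 4)"
        using less.prems 1 that by (intro less.hyps) simp_all
    qed (use less.prems 1 in \<open>simp_all add: exceptional_rotate[of b c a]\<close>)
    then show ?thesis by (rule efficient_rotate[OF efficient_rotate])
  next
    case 2
    have "efficient c a b"
    proof (rule efficient_if_ge_6)
      show "efficient c a (b - 4)" if "\<not> exceptional c a (b - 4)"
        using less.prems 2 that by (intro less.hyps) simp_all
    qed (use less.prems 2 in \<open>simp_all add: exceptional_rotate[of c a b] exceptional_rotate[of b c a]\<close>)
    then show ?thesis by (rule efficient_rotate)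
  next
    case 3
    show ?thesis
    proof (rule efficient_if_ge_6)
      show "efficient a b (c - 4)" if "\<not> exceptional a b (c - 4)"
        using less.prems 3 that by (intro less.hyps) simp_all
    qed (use less.prems 3 in simp_all)
  next
    case 4
    then show ?thesis
      using less.prems efficient_4[of b c] efficient_rotate[OF efficient_rotate[OF efficient_4[of c a]]]
        efficient_rotate[OF efficient_4[of a b]]
      by auto
  next
    case 5
    with less.prems show ?thesis by (intro efficient_small) auto
  qed
qed

text \<open>Cubes 2 x 2 x 2, covered exactly by two paths, are added to 2 x 2 x 3, so the excess
  stays at one path.\<close>

lemma coverable_2_2_odd:
  assumes "odd n" "n \<ge> 3"
  shows "coverable 2 2 n (n + 1)"
  using assms
proof (induction n rule: less_induct)
  case (less n)
  show ?case
  proof (cases "n = 3")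
    case False
    with less.prems have "n \<ge> 5"
      by (auto elim!: oddE)
    then obtain m where m: "n = m + 2" "m \<ge> 3"
      using that[of "n - 2"] by auto
    with less.prems have "coverable 2 2 m (m + 1)"
      by (intro less.IH) auto
    then have "coverable m 2 2 (m + 1)"
      by (rule coverable_swap12[OF coverable_swap23])
    from coverable_add[OF this coverable_2_2_2] have "coverable n 2 2 (n + 1)"
      by (simp add: m)
    then show ?thesis
      by (rule coverable_swap23[OF coverable_swap12])
  qed (use coverable_2_2_3 in simp)
qed

lemma coverable_swap12_iff: "coverable a b c k \<longleftrightarrow> coverable b a c k"
  using coverable_swap12 by blast

lemma coverable_swap23_iff: "coverable a b c k \<longleftrightarrow> coverable a c b k"
  using coverable_swap23 by blast

section \<open>The isometric path number\<close>

lemma isometric_path_number_efficient: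
  assumes "efficient a b c"
  shows "isometric_path_number (complete_product [a, b, c]) = (a * b * c + 3) div 4"
proof (rule antisym)
  show "isometric_path_number (complete_product [a, b, c]) \<le> (a * b * c + 3) div 4"
    using assms unfolding efficient_def by (rule isometric_path_number_le)
  show "(a * b * c + 3) div 4 \<le> isometric_path_number (complete_product [a, b, c])"
    using coverable_lower_bound[OF coverable_isometric_path_number[of a b c]] by linarith
qed

text \<open>The hypothesis \<open>perm\<close> treats the three positions of the odd side
  together.\<close>

lemma isometric_path_number_exceptional:
  assumes perm: "\<And>k. coverable a b c k \<longleftrightarrow> coverable 2 2 n k"
    and n: "odd n" "n \<ge> 2"
  shows "isometric_path_number (complete_product [a, b, c]) = n + 1"
proof (rule antisym)
  have "n \<ge> 3"
    using n by (cases "n = 2") auto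
  with n have "coverable 2 2 n (n + 1)"
    by (intro coverable_2_2_odd)
  then show "isometric_path_number (complete_product [a, b, c]) \<le> n + 1"
    by (intro isometric_path_number_le) (simp only: perm)
  let ?k = "isometric_path_number (complete_product [a, b, c])"
  have k: "coverable 2 2 n ?k"
    using coverable_isometric_path_number perm by blast
  \<comment> \<open>The volume bound gives \<open>n \<le> ?k\<close>, and parity excludes
    equality.\<close>
  then have "?k \<noteq> n"
    using coverable_2_2_even n by metis
  with coverable_lower_bound[OF k] show "n + 1 \<le> ?k"
    by simp
qed

lemma ceiling_quarter: "\<lceil>real m / 4\<rceil> = int ((m + 3) div 4)"
  by (rule ceiling_unique) linarith+

theorem theorem9:
  fixes n1 n2 n3 :: nat
  assumes "n1 \<ge> 2" and "n2 \<ge> 2" and "n3 \<ge> 2"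
  shows "(\<not> ((n1 = 2 \<and> n2 = 2 \<and> odd n3) \<or> (n1 = 2 \<and> n3 = 2 \<and> odd n2) \<or> (n2 = 2 \<and> n3 = 2 \<and> odd n1))
           \<longrightarrow> int (isometric_path_number (complete_product [n1, n2, n3]))
               = \<lceil>real (n1 * n2 * n3) / 4\<rceil>)
       \<and> ((n1 = 2 \<and> n2 = 2 \<and> odd n3) \<or> (n1 = 2 \<and> n3 = 2 \<and> odd n2) \<or> (n2 = 2 \<and> n3 = 2 \<and> odd n1)
           \<longrightarrow> real (isometric_path_number (complete_product [n1, n2, n3]))
               = real (n1 * n2 * n3) / 4 + 1)"
proof (intro conjI impI)
  assume "\<not> ((n1 = 2 \<and> n2 = 2 \<and> odd n3) \<or> (n1 = 2 \<and> n3 = 2 \<and> odd n2) \<or> (n2 = 2 \<and> n3 = 2 \<and> odd n1))"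
  then have "efficient n1 n2 n3"
    using assms by (intro efficient_if_not_exceptional) (simp_all add: exceptional_def)
  then show "int (isometric_path_number (complete_product [n1, n2, n3])) = \<lceil>real (n1 * n2 * n3) / 4\<rceil>"
    by (simp only: isometric_path_number_efficient ceiling_quarter)
next
  assume "(n1 = 2 \<and> n2 = 2 \<and> odd n3) \<or> (n1 = 2 \<and> n3 = 2 \<and> odd n2) \<or> (n2 = 2 \<and> n3 = 2 \<and> odd n1)"
  \<comment> \<open>With two sides equal to 2, a quarter of the volume is the third side.\<close>
  then show "real (isometric_path_number (complete_product [n1, n2, n3])) = real (n1 * n2 * n3) / 4 + 1"
  proof (elim disjE conjE)
    assume "n1 = 2" "n2 = 2" "odd n3"
    then show ?thesis
      using isometric_path_number_exceptional[of n1 n2 n3 n3] assms by simp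
  next
    assume "n1 = 2" "n3 = 2" "odd n2"
    then show ?thesis
      using isometric_path_number_exceptional[of n1 n2 n3 n2] assms
      by (simp add: coverable_swap23_iff[of 2 n2])
  next
    assume "n2 = 2" "n3 = 2" "odd n1"
    then show ?thesis
      using isometric_path_number_exceptional[of n1 n2 n3 n1] assms
      by (simp add: coverable_swap12_iff[of n1] coverable_swap23_iff[of 2 n1])
  qed
qed

end
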